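(* Let $\Lambda>0$, $\eta>0$, $x_1,\dots,x_M\in\mathbb{R}$, $z_k=x_k+i\eta$. Let $q_1,\dots,q_d\in L^\infty(0,\Lambda;\mathbb{C})$ and, for $\theta\in\mathbb{R}^d$ near $0$, let $H(\theta)(s)=\frac12I+X_{q_\theta(s)}$ with $q_\theta=\sum_{j=1}^d\theta_jq_j$, with free tail attached. Let $\mathcal{S}(\theta)=(v_{H(\theta),\Lambda}(z_k))_{k=1}^M\in\mathbb{C}^M$ and let $\mathcal{S}_{\mathbb{R}}$ be its realification (values in $\mathbb{R}^{2M}$). Assume that $\mathcal{S}_{\mathbb{R}}$ is $C^1$ on a neighborhood of $0\in\mathbb{R}^d$, that the Jacobian $D\mathcal{S}_{\mathbb{R}}(0)$ is injective, and that $D\mathcal{S}_{\mathbb{R}}$ is Lipschitz on a neighborhood of $0$. Then there exist $r,c,C>0$ such that for all $\theta,\widetilde\theta\in B(0,r)$, $$c\|\theta-\widetilde\theta\|_2\le\|\mathcal{S}(\theta)-\mathcal{S}(\widetilde\theta)\|_2\le C\|\theta-\widetilde\theta\|_2 .$$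
   Context: Let $J=\begin{pmatrix}0&-1\\1&0\end{pmatrix}$. A trace-normed Hamiltonian on $[0,\Lambda]$ is a measurable $H:[0,\Lambda]\to\mathbb{R}^{2\times2}$ with $H(s)$ symmetric, $H(s)\succeq0$ and $\operatorname{tr}H(s)=1$ for a.e. $s$; it is extended to $[0,\infty)$ by the free tail $H(s)=\frac12I$ for $s\ge\Lambda$. For $\operatorname{Im}z>0$, the Weyl coefficient $m_{H,\Lambda}(z)$ is the unique $m\in\mathbb{C}$ such that the solution of $JY'(s)=zH(s)Y(s)$ on $[0,\infty)$ with $Y(0)=(1,m)^\top$ is square-integrable, i.e. $\int_0^\infty Y^*HY\,ds<\infty$; it satisfies $\operatorname{Im}m_{H,\Lambda}(z)>0$. Its Schur transform is $v_{H,\Lambda}(z)=\dfrac{m_{H,\Lambda}(z)-i}{m_{H,\Lambda}(z)+i}$. For $q\in\mathbb{C}$, $X_q:=\begin{pmatrix}\operatorname{Re}q&\operatorname{Im}q\\ \operatorname{Im}q&-\operatorname{Re}q\end{pmatrix}$. For $\theta$ near $0$, $H(\theta)$ is a trace-normed Hamiltonian. $\mathbb{C}^M$ is identified with $\mathbb{R}^{2M}$ via real and imaginary parts; differentiability means real Fréchet differentiability after this identification. $B(0,r)$ is the Euclidean ball of radius $r$ in $\mathbb{R}^d$. *)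

theory Defs
  imports "HOL-Analysis.Analysis"
begin

definition Jmat :: "complex^2^2" where
  "Jmat = vector [vector [0, -1], vector [1, 0]]"

definition trace_normed_hamiltonian :: "real \<Rightarrow> (real \<Rightarrow> real^2^2) \<Rightarrow> bool" where
  "trace_normed_hamiltonian \<Lambda> H \<longleftrightarrow>
     H \<in> borel_measurable (lebesgue_on {0..\<Lambda>}) \<and>
     (AE s in lebesgue_on {0..\<Lambda>}.
        transpose (H s) = H s \<and> (\<forall>v. 0 \<le> v \<bullet> (H s *v v)) \<and> trace (H s) = 1)"

definition free_tail :: "real \<Rightarrow> (real \<Rightarrow> real^2^2) \<Rightarrow> real \<Rightarrow> real^2^2" where
  "free_tail \<Lambda> H s = (if s < \<Lambda> then H s else (1/2) *\<^sub>R mat 1)"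

definition abs_continuous_on :: "real \<Rightarrow> real \<Rightarrow> (real \<Rightarrow> 'a::real_normed_vector) \<Rightarrow> bool" where
  "abs_continuous_on \<alpha> \<beta> f \<longleftrightarrow>
     (\<forall>\<epsilon>>0. \<exists>\<delta>>0. \<forall>(n::nat) a b.
        (\<forall>i<n. \<alpha> \<le> a i \<and> a i \<le> b i \<and> b i \<le> \<beta>) \<and>
        disjoint_family_on (\<lambda>i. {a i<..<b i}) {..<n} \<and>
        (\<Sum>i<n. b i - a i) < \<delta>
        \<longrightarrow> (\<Sum>i<n. norm (f (b i) - f (a i))) < \<epsilon>)"

(* Solutions are understood in the Caratheodory sense (H is merely measurable): Y is locally
   absolutely continuous on [0,oo) and satisfies the equation almost everywhere. *)
definition canonical_solution :: "(real \<Rightarrow> real^2^2) \<Rightarrow> complex \<Rightarrow> (real \<Rightarrow> complex^2) \<Rightarrow> bool" where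
  "canonical_solution H z Y \<longleftrightarrow>
     (\<forall>b>0. abs_continuous_on 0 b Y) \<and>
     (AE s in lebesgue_on {0..}. \<exists>Y'. (Y has_vector_derivative Y') (at s) \<and>
        Jmat *v Y' = z *s (map_matrix complex_of_real (H s) *v Y s))"

(* The integrand is Y^* H Y; it is real and nonnegative when H is symmetric and positive
   semidefinite, which is why passing to Re and ennreal loses nothing. *)
definition hamiltonian_square_integrable ::
    "(real \<Rightarrow> real^2^2) \<Rightarrow> (real \<Rightarrow> complex^2) \<Rightarrow> bool" where
  "hamiltonian_square_integrable H Y \<longleftrightarrow>
     (\<integral>\<^sup>+ s. ennreal (Re (\<Sum>i\<in>UNIV. cnj (Y s $ i) * (map_matrix complex_of_real (H s) *v Y s) $ i))
        \<partial>lebesgue_on {0..}) < \<infinity>"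

(* By the limit-point property there is exactly one such m if H is a trace-normed Hamiltonian and
   Im z > 0; otherwise the value is unspecified. *)
definition weyl_coefficient :: "real \<Rightarrow> (real \<Rightarrow> real^2^2) \<Rightarrow> complex \<Rightarrow> complex" where
  "weyl_coefficient \<Lambda> H z =
     (THE m. \<exists>Y. canonical_solution (free_tail \<Lambda> H) z Y \<and> Y 0 = vector [1, m] \<and>
        hamiltonian_square_integrable (free_tail \<Lambda> H) Y)"

definition schur_transform :: "real \<Rightarrow> (real \<Rightarrow> real^2^2) \<Rightarrow> complex \<Rightarrow> complex" where
  "schur_transform \<Lambda> H z =
     (weyl_coefficient \<Lambda> H z - \<i>) / (weyl_coefficient \<Lambda> H z + \<i>)"

definition Xmat :: "complex \<Rightarrow> real^2^2" where
  "Xmat q = vector [vector [Re q, Im q], vector [Im q, - Re q]]"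

definition Linfty :: "real \<Rightarrow> (real \<Rightarrow> complex) \<Rightarrow> bool" where
  "Linfty \<Lambda> f \<longleftrightarrow> f \<in> borel_measurable (lebesgue_on {0<..<\<Lambda>}) \<and>
     (\<exists>K. AE s in lebesgue_on {0<..<\<Lambda>}. norm (f s) \<le> K)"

definition q_family :: "('d::finite \<Rightarrow> real \<Rightarrow> complex) \<Rightarrow> real^'d \<Rightarrow> real \<Rightarrow> complex" where
  "q_family q \<theta> s = (\<Sum>j\<in>UNIV. (\<theta> $ j) *\<^sub>R q j s)"

definition hamiltonian_family :: "('d::finite \<Rightarrow> real \<Rightarrow> complex) \<Rightarrow> real^'d \<Rightarrow> real \<Rightarrow> real^2^2" where
  "hamiltonian_family q \<theta> s = (1/2) *\<^sub>R mat 1 + Xmat (q_family q \<theta> s)"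

definition sampling_map ::
    "real \<Rightarrow> real \<Rightarrow> real^'m \<Rightarrow> ('d::finite \<Rightarrow> real \<Rightarrow> complex) \<Rightarrow> real^'d \<Rightarrow> complex^'m" where
  "sampling_map \<Lambda> \<eta> x q \<theta> =
     (\<chi> k. schur_transform \<Lambda> (hamiltonian_family q \<theta>) (Complex (x $ k) \<eta>))"

(* C^M = R^2M, the 2M real coordinates being indexed by two copies of the index set of C^M. *)
definition realify :: "complex^'m \<Rightarrow> real^('m + 'm)" where
  "realify v = (\<chi> i. case i of Inl k \<Rightarrow> Re (v $ k) | Inr k \<Rightarrow> Im (v $ k))"

lemma Xmat_psd:
  assumes "norm q \<le> 1/2"
  shows "0 \<le> v \<bullet> (((1/2) *\<^sub>R mat 1 + Xmat q) *v v)"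
proof -
  define a b where "a = v $ 1" and "b = v $ 2"
  define w where "w = Complex (a\<^sup>2 - b\<^sup>2) (2 * a * b)"
  have w: "norm w = a\<^sup>2 + b\<^sup>2"
  proof (rule power2_eq_imp_eq)
    show "(norm w)\<^sup>2 = (a\<^sup>2 + b\<^sup>2)\<^sup>2"
      by (simp add: w_def cmod_power2) (simp add: power2_eq_square algebra_simps)
  qed auto
  have "- (q \<bullet> w) \<le> norm q * norm w"
    using Cauchy_Schwarz_ineq2[of q w] by linarith
  also have "\<dots> \<le> 1/2 * (a\<^sup>2 + b\<^sup>2)"
    unfolding w using assms by (intro mult_right_mono) auto
  finally have "0 \<le> 1/2 * (a\<^sup>2 + b\<^sup>2) + q \<bullet> w" by linarith
  also have "\<dots> = v \<bullet> (((1/2) *\<^sub>R mat 1 + Xmat q) *v v)"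
    by (simp add: inner_vec_def matrix_vector_mult_def Xmat_def sum_2 mat_def a_def b_def w_def
        inner_complex_def power2_eq_square algebra_simps)
  finally show ?thesis .
qed

lemma lebesgue_on_Icc_Ioo:
  "(AE s in lebesgue_on {0<..<\<Lambda>}. P s) \<Longrightarrow> (AE s in lebesgue_on {0..\<Lambda>::real}. P s)"
proof -
  assume *: "AE s in lebesgue_on {0<..<\<Lambda>}. P s"
  have "{0, \<Lambda>} \<in> null_sets lebesgue"
    by (simp add: negligible_iff_null_sets [symmetric])
  then have "AE s in lebesgue. s \<notin> {0, \<Lambda>}" by (rule AE_not_in)
  moreover have "AE s in lebesgue. s \<in> {0<..<\<Lambda>} \<longrightarrow> P s"
    using * by (simp add: AE_restrict_space_iff)
  ultimately have "AE s in lebesgue. s \<in> {0..\<Lambda>} \<longrightarrow> P s"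
    by eventually_elim auto
  then show ?thesis by (simp add: AE_restrict_space_iff)
qed

lemma borel_measurable_Icc_Ioo:
  fixes f :: "real \<Rightarrow> complex"
  assumes "f \<in> borel_measurable (lebesgue_on {0<..<\<Lambda>})"
  shows "f \<in> borel_measurable (lebesgue_on {0..\<Lambda>})"
proof -
  define g where "g = (\<lambda>s. if s \<in> {0<..<\<Lambda>} then f s else 0)"
  have [measurable]: "g \<in> borel_measurable lebesgue"
    using assms unfolding g_def by (subst borel_measurable_if) auto
  have "(\<lambda>s. if s \<in> {0..\<Lambda>} then f s else 0)
      = (\<lambda>s. g s + indicat_real ({0} \<inter> {0..\<Lambda>}) s *\<^sub>R f 0 + indicat_real ({\<Lambda>} \<inter> {0<..\<Lambda>}) s *\<^sub>R f \<Lambda>)"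
    by (auto simp: g_def fun_eq_iff indicator_def)
  also have "\<dots> \<in> borel_measurable lebesgue"
    by (intro borel_measurable_add borel_measurable_scaleR borel_measurable_indicator) auto
  finally show ?thesis by (subst (asm) borel_measurable_if) auto
qed

(* For essentially bounded q_j the requirement that H(theta) be a trace-normed Hamiltonian for
   theta near 0 is automatic, so it does not have to be imposed separately. *)
lemma hamiltonian_family_trace_normed:
  fixes q :: "'d::finite \<Rightarrow> real \<Rightarrow> complex"
  assumes "\<And>j. Linfty \<Lambda> (q j)"
  shows "eventually (\<lambda>\<theta>. trace_normed_hamiltonian \<Lambda> (hamiltonian_family q \<theta>)) (nhds 0)"
proof -
  have "\<exists>K. \<forall>j. AE s in lebesgue_on {0<..<\<Lambda>}. norm (q j s) \<le> K j"
    using assms unfolding Linfty_def by metis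
  then obtain K where K: "\<And>j. AE s in lebesgue_on {0..\<Lambda>}. norm (q j s) \<le> K j"
    using lebesgue_on_Icc_Ioo by metis
  define B where "B = (\<Sum>j\<in>UNIV. \<bar>K j\<bar>) + 1"
  have B: "B > 0" unfolding B_def by (smt (verit) sum_nonneg abs_ge_zero)
  have meas: "q j \<in> borel_measurable (lebesgue_on {0..\<Lambda>})" for j
    using assms[of j] unfolding Linfty_def by (intro borel_measurable_Icc_Ioo) (rule conjunct1)
  have "trace_normed_hamiltonian \<Lambda> (hamiltonian_family q \<theta>)" if \<theta>: "norm \<theta> < 1 / (2 * B)" for \<theta>
    unfolding trace_normed_hamiltonian_def
  proof (intro conjI)
    have [measurable]: "q_family q \<theta> \<in> borel_measurable (lebesgue_on {0..\<Lambda>})"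
      unfolding q_family_def
      by (intro borel_measurable_sum borel_measurable_scaleR borel_measurable_const meas)
    have [measurable]: "(\<lambda>s. Re (q_family q \<theta> s)) \<in> borel_measurable (lebesgue_on {0..\<Lambda>})"
      "(\<lambda>s. Im (q_family q \<theta> s)) \<in> borel_measurable (lebesgue_on {0..\<Lambda>})"
      by measurable
    have "(\<lambda>s. hamiltonian_family q \<theta> s \<bullet> axis i (axis j 1)) \<in> borel_measurable (lebesgue_on {0..\<Lambda>})" for i j
      using exhaust_2[of i] exhaust_2[of j]
      by (auto simp: inner_axis hamiltonian_family_def Xmat_def mat_def)
    then have "\<forall>e\<in>Basis. (\<lambda>s. hamiltonian_family q \<theta> s \<bullet> e) \<in> borel_measurable (lebesgue_on {0..\<Lambda>})"
      unfolding Basis_vec_def by fastforce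
    then show "hamiltonian_family q \<theta> \<in> borel_measurable (lebesgue_on {0..\<Lambda>})"
      by (simp only: borel_measurable_euclidean_space [of "hamiltonian_family q \<theta>"])
    have "AE s in lebesgue_on {0..\<Lambda>}. \<forall>j\<in>UNIV. norm (q j s) \<le> K j"
      using K by (intro AE_finite_allI) auto
    then show "AE s in lebesgue_on {0..\<Lambda>}. transpose (hamiltonian_family q \<theta> s) = hamiltonian_family q \<theta> s \<and>
        (\<forall>v. 0 \<le> v \<bullet> (hamiltonian_family q \<theta> s *v v)) \<and> trace (hamiltonian_family q \<theta> s) = 1"
    proof eventually_elim
      case (elim s)
      have "norm (q_family q \<theta> s) \<le> (\<Sum>j\<in>UNIV. norm \<theta> * \<bar>K j\<bar>)"
        unfolding q_family_def
      proof (intro sum_norm_le)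
        fix j
        show "norm ((\<theta> $ j) *\<^sub>R q j s) \<le> norm \<theta> * \<bar>K j\<bar>"
          using elim component_le_norm_cart[of \<theta> j]
          by (simp, intro mult_mono) (auto intro: order_trans[OF _ abs_ge_self])
      qed
      also have "\<dots> \<le> norm \<theta> * B"
        unfolding B_def by (simp add: sum_distrib_left [symmetric] mult_left_mono)
      also have "\<dots> \<le> 1/2" using \<theta> B by (simp add: field_simps)
      finally have "norm (q_family q \<theta> s) \<le> 1/2" .
      then show ?case
        using Xmat_psd[of "q_family q \<theta> s"]
        by (auto simp: hamiltonian_family_def transpose_def trace_def sum_2 Xmat_def mat_def
            vec_eq_iff forall_2)
    qed
  qed
  then show ?thesis
    unfolding eventually_nhds_metric using B
    by (intro exI[of _ "1 / (2 * B)"]) auto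
qed

end

theory Submission
  imports Defs
begin

text \<open>
  This is the quantitative core of the inverse function theorem: subtracting the injective
  derivative at the centre from the map leaves a remainder with small derivative, hence with small
  Lipschitz constant on a ball.
\<close>

lemma realify_diff: "realify (u - v) = realify u - realify v"
  by (simp add: realify_def vec_eq_iff split: sum.split)

text \<open>Together with \<open>realify_diff\<close> this makes \<open>realify\<close>
  distance-preserving, so a two-sided bound proved in real coordinates is already the bound in the
  complex space.\<close>

lemma norm_realify:
  fixes v :: "complex^'m"
  shows "norm (realify v) = norm v"
proof -
  have "(\<Sum>i\<in>UNIV. (norm (realify v $ i))\<^sup>2)
      = (\<Sum>k\<in>UNIV. (Re (v $ k))\<^sup>2) + (\<Sum>k\<in>UNIV. (Im (v $ k))\<^sup>2)"
    using sum.Plus[of "UNIV :: 'm set" "UNIV :: 'm set" "\<lambda>i. (norm (realify v $ i))\<^sup>2"]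
    by (simp add: realify_def)
  also have "\<dots> = (\<Sum>k\<in>UNIV. (norm (v $ k))\<^sup>2)"
    by (simp add: cmod_power2 sum.distrib)
  finally show ?thesis
    by (simp add: norm_vec_def L2_set_def)
qed

lemma local_bilipschitz_injective_derivative:
  fixes f :: "'a::euclidean_space \<Rightarrow> 'b::euclidean_space"
    and f' :: "'a \<Rightarrow> 'a \<Rightarrow>\<^sub>L 'b"
  assumes "open U" and "a \<in> U"
    and der: "\<And>x. x \<in> U \<Longrightarrow> (f has_derivative blinfun_apply (f' x)) (at x)"
    and cont: "isCont f' a"
    and inj: "inj (blinfun_apply (f' a))"
  shows "\<exists>r>0. \<exists>c>0. \<exists>C>0. \<forall>x\<in>ball a r. \<forall>y\<in>ball a r.
    c * norm (x - y) \<le> norm (f x - f y) \<and> norm (f x - f y) \<le> C * norm (x - y)"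
proof -
  have "linear (blinfun_apply (f' a))"
    using blinfun.bounded_linear_right bounded_linear.linear by blast
  \<comment> \<open>In finite dimensions an injective linear map is bounded below: its norm attains
    a positive minimum on the unit sphere.\<close>
  then obtain B where B: "B > 0" "\<And>x. B * norm x \<le> norm (f' a x)"
    using linear_inj_bounded_below_pos[OF _ inj] by blast
  \<comment> \<open>The tolerance \<open>B / 2\<close> lets the remainder consume only half of the
    lower bound \<open>B\<close>.\<close>
  obtain d where d: "d > 0" "\<And>x. dist x a < d \<Longrightarrow> dist (f' x) (f' a) < B / 2"
    using cont B(1) unfolding continuous_at_eps_delta by (meson half_gt_zero)
  obtain e where e: "e > 0" "ball a e \<subseteq> U"
    using \<open>open U\<close> \<open>a \<in> U\<close> open_contains_ball by blast
  define r where "r = min d e"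
  define g where "g x = f x - f' a x" for x
  \<comment> \<open>Mean value inequality on the convex ball: radius \<open>e\<close> keeps it
    inside \<open>U\<close>, where \<open>g\<close> has derivative \<open>f' x - f' a\<close>, and
    radius \<open>d\<close> keeps the operator norm of that derivative below
    \<open>B / 2\<close>.\<close>
  have g: "norm (g x - g y) \<le> B / 2 * norm (x - y)" if "x \<in> ball a r" "y \<in> ball a r" for x y
  proof (rule differentiable_bound)
    show "convex (ball a r)" by simp
    fix x assume x: "x \<in> ball a r"
    have "x \<in> U" using x e(2) by (auto simp: r_def)
    then show "(g has_derivative blinfun_apply (f' x - f' a)) (at x within ball a r)"
      unfolding g_def minus_blinfun.rep_eq
      by (rule has_derivative_at_withinI[OF has_derivative_diff[OF der
            bounded_linear_imp_has_derivative[OF blinfun.bounded_linear_right]]])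
    show "onorm (blinfun_apply (f' x - f' a)) \<le> B / 2"
      using d(2)[of x] x by (simp add: r_def dist_norm norm_blinfun.rep_eq norm_minus_commute)
  qed (use that in auto)
  show ?thesis
  proof (intro exI conjI ballI)
    show "r > 0" "B / 2 > 0" using d e B by (auto simp: r_def)
    show "norm (f' a) + B / 2 > 0" using B by (simp add: add_nonneg_pos)
    fix x y assume "x \<in> ball a r" "y \<in> ball a r"
    note rem = g[OF this]
    \<comment> \<open>Linear part plus remainder: the reverse triangle inequality leaves
      \<open>B - B / 2\<close> for the lower constant, and the triangle inequality gives the upper
      one.\<close>
    have eq: "f x - f y = f' a (x - y) + (g x - g y)"
      by (simp add: g_def blinfun.diff_right)
    have "B * norm (x - y) - B / 2 * norm (x - y) \<le> norm (f x - f y)"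
      unfolding eq using B(2)[of "x - y"] rem norm_diff_ineq[of "f' a (x - y)" "g x - g y"] by linarith
    moreover have "norm (f x - f y) \<le> norm (f' a) * norm (x - y) + B / 2 * norm (x - y)"
      unfolding eq using norm_blinfun[of "f' a" "x - y"] rem
        norm_triangle_ineq[of "f' a (x - y)" "g x - g y"] by linarith
    ultimately show "B / 2 * norm (x - y) \<le> norm (f x - f y)"
      "norm (f x - f y) \<le> (norm (f' a) + B / 2) * norm (x - y)"
      by (simp_all add: algebra_simps)
  qed
qed

theorem theorem1p2:
  fixes \<Lambda> \<eta> :: real
    and x :: "real^'m"
    and q :: "'d::finite \<Rightarrow> real \<Rightarrow> complex"
    and U V :: "(real^'d) set"
    and DS :: "real^'d \<Rightarrow> ((real^'d) \<Rightarrow>\<^sub>L (real^('m + 'm)))"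
  assumes "\<Lambda> > 0" and "\<eta> > 0"
    and "\<And>j. Linfty \<Lambda> (q j)"
    and "open U" and "0 \<in> U"
    and "\<And>\<theta>. \<theta> \<in> U \<Longrightarrow>
      ((\<lambda>t. realify (sampling_map \<Lambda> \<eta> x q t)) has_derivative blinfun_apply (DS \<theta>)) (at \<theta>)"
    and "continuous_on U DS"
    and "inj (blinfun_apply (DS 0))"
    and "open V" and "0 \<in> V" and "V \<subseteq> U"
    and "\<exists>L. L-lipschitz_on V DS"
  shows "\<exists>r>0. \<exists>c>0. \<exists>C>0. \<forall>\<theta>\<in>ball 0 r. \<forall>\<theta>'\<in>ball 0 r.
    c * norm (\<theta> - \<theta>') \<le> norm (sampling_map \<Lambda> \<eta> x q \<theta> - sampling_map \<Lambda> \<eta> x q \<theta>') \<and>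
    norm (sampling_map \<Lambda> \<eta> x q \<theta> - sampling_map \<Lambda> \<eta> x q \<theta>') \<le> C * norm (\<theta> - \<theta>')"
proof -
  have "isCont DS 0"
    using assms(4,5,7) continuous_on_eq_continuous_at by blast
  \<comment> \<open>The lemma bounds the realified sampling map near 0; the isometry
    \<open>realify\<close> is then stripped from both estimates.\<close>
  from local_bilipschitz_injective_derivative[OF assms(4,5,6) this assms(8)] show ?thesis
    unfolding realify_diff [symmetric] norm_realify .
qed

end
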